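(* Let $[a,b,c]$ be a primitive Pythagorean triple, let $G=\tfrac12ab$ be the area of the right triangle with legs $a,b$, and put $$r_1=\tfrac12(a+b-c),\quad r_2=\tfrac12(a-b+c),\quad r_3=\tfrac12(-a+b+c),\quad r_4=\tfrac12(a+b+c).$$ Consider the four circles centered at the vertices of a rectangle with sides $a/G$ and $b/G$, namely with centers $(0,0)$, $(a/G,0)$, $(0,b/G)$, $(a/G,b/G)$ and radii $r_1/G$, $r_2/G$, $r_3/G$, $r_4/G$ respectively. These circles are pairwise tangent, the fourth enclosing the other three, and their oriented curvatures are the integers $r_4,\ r_3,\ r_2,\ -r_1$ respectively, which have greatest common divisor $1$ and satisfy the Descartes Circle Equation. Consequently these four circles generate an integral Apollonian packing, which contains four circles whose centers form a rectangle.
   Context: A primitive Pythagorean triple consists of positive integers $a,b,c$ with $a^2+b^2=c^2$ and $\gcd(a,b,c)=1$. The oriented curvature of a circle of radius $r$ in such a configuration is $1/r$, except that it is $-1/r$ for the circle enclosing the others. A quadruple $[k_1,k_2,k_3,k_4]$ satisfies the Descartes Circle Equation if $k_1^2+k_2^2+k_3^2+k_4^2=\tfrac12(k_1+k_2+k_3+k_4)^2$. Given four pairwise tangent circles (tangent at six distinct points), Descartes reflection replaces one of the circles by the other circle tangent to the remaining three. The Apollonian packing generated by four such circles is the collection of all circles obtained from them by repeated Descartes reflections; it is integral if all its circles have integer oriented curvature. *)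

theory Defs
  imports "HOL-Analysis.Analysis"
begin

definition primitive_pythagorean_triple :: "int \<Rightarrow> int \<Rightarrow> int \<Rightarrow> bool" where
  "primitive_pythagorean_triple a b c \<longleftrightarrow>
     a > 0 \<and> b > 0 \<and> c > 0 \<and> a\<^sup>2 + b\<^sup>2 = c\<^sup>2 \<and> Gcd {a, b, c} = 1"

definition descartes_equation :: "real \<Rightarrow> real \<Rightarrow> real \<Rightarrow> real \<Rightarrow> bool" where
  "descartes_equation k1 k2 k3 k4 \<longleftrightarrow>
     k1\<^sup>2 + k2\<^sup>2 + k3\<^sup>2 + k4\<^sup>2 = 1 / 2 * (k1 + k2 + k3 + k4)\<^sup>2"

(* The metric on real * real is the Euclidean one. Only values with positive radius are
   genuine circles; this is enforced in tangent below. *)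
datatype circle = Circle (center: "real \<times> real") (radius: real)

definition points :: "circle \<Rightarrow> (real \<times> real) set" where
  "points C = sphere (center C) (radius C)"

(* Covers both external and internal tangency; no circle is tangent to itself. *)
definition tangent :: "circle \<Rightarrow> circle \<Rightarrow> bool" where
  "tangent C D \<longleftrightarrow> radius C > 0 \<and> radius D > 0 \<and> (\<exists>!p. p \<in> points C \<inter> points D)"

definition tangency_point :: "circle \<Rightarrow> circle \<Rightarrow> real \<times> real" where
  "tangency_point C D = (THE p. p \<in> points C \<inter> points D)"

definition encloses :: "circle \<Rightarrow> circle \<Rightarrow> bool" where
  "encloses C D \<longleftrightarrow> cball (center D) (radius D) \<subseteq> cball (center C) (radius C)"

(* The sign depends on the ambient family F (a configuration or a whole packing). *)
definition oriented_curvature :: "circle set \<Rightarrow> circle \<Rightarrow> real" where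
  "oriented_curvature F C =
     (if \<forall>D\<in>F - {C}. encloses C D then - 1 / radius C else 1 / radius C)"

definition descartes_quadruple :: "circle list \<Rightarrow> bool" where
  "descartes_quadruple Q \<longleftrightarrow>
     length Q = 4 \<and>
     (\<forall>i<4. \<forall>j<4. i \<noteq> j \<longrightarrow> tangent (Q ! i) (Q ! j)) \<and>
     inj_on (\<lambda>(i, j). tangency_point (Q ! i) (Q ! j)) {(i, j). i < j \<and> j < 4}"

(* Three circles pairwise tangent at distinct points have exactly two common tangent circles,
   a straight line being allowed as a degenerate one. Lines are not modelled: they cannot
   arise when one circle of the starting quadruple encloses the other three, because then
   all circles obtained stay inside it. *)
definition descartes_reflection :: "circle list \<Rightarrow> circle list \<Rightarrow> bool" where
  "descartes_reflection Q Q' \<longleftrightarrow>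
     (\<exists>i<length Q. \<exists>D. D \<noteq> Q ! i \<and>
        (\<forall>j<length Q. j \<noteq> i \<longrightarrow> tangent D (Q ! j)) \<and> Q' = Q[i := D])"

definition apollonian_packing :: "circle list \<Rightarrow> circle set" where
  "apollonian_packing Q = (\<Union>Q' \<in> {Q'. descartes_reflection\<^sup>*\<^sup>* Q Q'}. set Q')"

definition integral_packing :: "circle set \<Rightarrow> bool" where
  "integral_packing P \<longleftrightarrow> (\<forall>C\<in>P. oriented_curvature P C \<in> \<int>)"

(* Nondegenerate rectangle with vertices listed in cyclic order. *)
definition is_rectangle ::
  "real \<times> real \<Rightarrow> real \<times> real \<Rightarrow> real \<times> real \<Rightarrow> real \<times> real \<Rightarrow> bool" where
  "is_rectangle A B C D \<longleftrightarrow>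
     A \<noteq> B \<and> A \<noteq> D \<and> B - A = C - D \<and> (B - A) \<bullet> (D - A) = 0"

end

theory Submission
  imports Defs
begin

text \<open>
  A circle with centre \<open>z\<close> and signed radius \<open>\<rho>\<close> is encoded as the vector
  \<open>(1/\<rho>, z/\<rho>, (|z|\<^sup>2 - \<rho>\<^sup>2)/\<rho>)\<close> of a four-dimensional Lorentz space. All these vectors
  have norm 1, and two oriented circles are tangent iff their product is \<open>-1\<close>. The Gram matrix of
  four mutually tangent circles is nonsingular, so a circle tangent to three of them is determined
  by its products with them, up to a quadratic equation whose second root is
  \<open>2 (A + B + C) - D\<close>. Reading off first components, a reflection keeps curvatures integral.
\<close>

section \<open>The Lorentz space of oriented circles\<close>

text \<open>The form has signature (3,1): Euclidean on the middle component, and a hyperbolic plane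
  in null coordinates on the two outer ones.\<close>

definition lform :: "real \<times> (real \<times> real) \<times> real \<Rightarrow> real \<times> (real \<times> real) \<times> real \<Rightarrow> real" where
  "lform X Y = fst (snd X) \<bullet> fst (snd Y) - (fst X * snd (snd Y) + snd (snd X) * fst Y) / 2"

lemma lform_commute: "lform X Y = lform Y X"
  by (simp add: lform_def inner_commute algebra_simps)

lemma lform_add_left: "lform (X + Y) Z = lform X Z + lform Y Z"
  by (simp add: lform_def inner_add_left field_simps)

lemma lform_diff_left: "lform (X - Y) Z = lform X Z - lform Y Z"
  by (simp add: lform_def inner_diff_left field_simps)

lemma lform_scaleR_left: "lform (t *\<^sub>R X) Z = t * lform X Z"
  by (simp add: lform_def algebra_simps)

lemmas lform_linear = lform_add_left lform_diff_left lform_scaleR_left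

lemma lform_zero_left: "lform 0 Z = 0"
  by (simp add: lform_def)

lemma lform_nondegenerate:
  assumes "\<And>Y. lform X Y = 0"
  shows "X = 0"
proof -
  obtain k u w where X: "X = (k, u, w)" by (metis prod_cases3)
  have "u = 0" using assms[of "(0, u, 0)"] by (simp add: X lform_def)
  moreover have "k = 0" using assms[of "(0, 0, 1)"] by (simp add: X lform_def)
  moreover have "w = 0" using assms[of "(1, 0, 0)"] by (simp add: X lform_def)
  ultimately show ?thesis by (simp add: X zero_prod_def)
qed

text \<open>The Gram matrix is \<open>2 I - J\<close>, with \<open>J\<close> the all-ones matrix;
  for circle vectors this says that four oriented circles are mutually tangent.\<close>

definition descartes_frame where
  "descartes_frame A B C D \<longleftrightarrow>
     lform A A = 1 \<and> lform B B = 1 \<and> lform C C = 1 \<and> lform D D = 1 \<and>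
     lform A B = -1 \<and> lform A C = -1 \<and> lform A D = -1 \<and>
     lform B C = -1 \<and> lform B D = -1 \<and> lform C D = -1"

text \<open>Pairing a vanishing linear combination with each of the four vectors gives a linear
  system with the nonsingular matrix \<open>2 I - J\<close>, so the vectors are independent; the
  space has dimension 4.\<close>

lemma descartes_frame_span:
  assumes "descartes_frame A B C D"
  shows "span {A, B, C, D} = UNIV"
proof -
  note f = assms[unfolded descartes_frame_def]
  have f': "lform B A = -1" "lform C A = -1" "lform D A = -1"
    "lform C B = -1" "lform D B = -1" "lform D C = -1"
    using f by (simp_all add: lform_commute)
  have dist: "A \<noteq> B" "A \<noteq> C" "A \<noteq> D" "B \<noteq> C" "B \<noteq> D" "C \<noteq> D"
    using f by auto
  have "independent {A, B, C, D}"
  proof (rule independent_if_scalars_zero)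
    fix h X assume s: "(\<Sum>x\<in>{A, B, C, D}. h x *\<^sub>R x) = 0" and X: "X \<in> {A, B, C, D}"
    have e: "h A *\<^sub>R A + h B *\<^sub>R B + h C *\<^sub>R C + h D *\<^sub>R D = 0"
      using s dist by (simp add: add.assoc)
    have "lform (h A *\<^sub>R A + h B *\<^sub>R B + h C *\<^sub>R C + h D *\<^sub>R D) Z = 0" for Z
      by (simp add: e lform_zero_left)
    from this[of A] this[of B] this[of C] this[of D]
    have "h A = 0 \<and> h B = 0 \<and> h C = 0 \<and> h D = 0"
      using f f' by (simp add: lform_linear)
    then show "h X = 0" using X by auto
  qed simp
  moreover have "card {A, B, C, D} = 4" using dist by simp
  ultimately show ?thesis
    using card_ge_dim_independent[of "{A, B, C, D}" UNIV] by auto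
qed

text \<open>The coefficients come from the inverse Gram matrix \<open>I / 2 - J / 4\<close>. The
  difference of the two sides is orthogonal to the frame, hence to its span, hence zero by
  nondegeneracy.\<close>

lemma descartes_frame_expansion:
  assumes "descartes_frame A B C D"
    and T: "T = lform X A + lform X B + lform X C + lform X D"
  shows "X = ((2 * lform X A - T) / 4) *\<^sub>R A + ((2 * lform X B - T) / 4) *\<^sub>R B
    + ((2 * lform X C - T) / 4) *\<^sub>R C + ((2 * lform X D - T) / 4) *\<^sub>R D" (is "X = ?Y")
proof -
  note f = assms(1)[unfolded descartes_frame_def]
  have f': "lform B A = -1" "lform C A = -1" "lform D A = -1"
    "lform C B = -1" "lform D B = -1" "lform D C = -1"
    using f by (simp_all add: lform_commute)
  define E where "E = X - ?Y"
  have z: "lform E A = 0" "lform E B = 0" "lform E C = 0" "lform E D = 0"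
    unfolding E_def using f f' by (simp_all add: lform_linear T field_simps)
  have "lform Z E = 0" for Z
  proof -
    have "Z \<in> span {A, B, C, D}" using descartes_frame_span[OF assms(1)] by simp
    then show ?thesis
    proof (induction rule: span_induct_alt)
      case base
      then show ?case by (simp add: lform_zero_left)
    next
      case (step c x y)
      then have "lform x E = 0" using z by (auto simp: lform_commute)
      then show ?case using step by (simp add: lform_linear)
    qed
  qed
  then have "E = 0" using lform_nondegenerate[of E] by (simp add: lform_commute)
  then show ?thesis by (simp add: E_def)
qed

text \<open>A product of \<open>1\<close> instead of \<open>-1\<close> means tangency after one
  orientation is reversed, so all sign patterns must be treated. Norm 1 leaves a quadratic equation
  for the product with \<open>D\<close>; the sign \<open>s\<close> fixes the orientation of
  \<open>X\<close>.\<close>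

lemma descartes_frame_tangent_cases:
  assumes frame: "descartes_frame A B C D"
    and X: "lform X X = 1"
    and "lform X A \<in> {1, -1}" "lform X B \<in> {1, -1}" "lform X C \<in> {1, -1}"
  shows "\<exists>s\<in>{1, -1}. s *\<^sub>R X \<in> {A, B, C, D, 2 *\<^sub>R (A + B + C) - D}"
proof -
  define \<alpha> \<beta> \<gamma> t where d: "\<alpha> = lform X A" "\<beta> = lform X B" "\<gamma> = lform X C" "t = lform X D"
  define T where T: "T = \<alpha> + \<beta> + \<gamma> + t"
  have ex: "X = ((2 * \<alpha> - T) / 4) *\<^sub>R A + ((2 * \<beta> - T) / 4) *\<^sub>R B
    + ((2 * \<gamma> - T) / 4) *\<^sub>R C + ((2 * t - T) / 4) *\<^sub>R D" (is "X = ?Y")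
    using descartes_frame_expansion[OF frame, of T X] by (simp add: d T)
  \<comment> \<open>Expanding only the left argument leaves the known products and the single
    unknown \<open>t\<close>.\<close>
  have "1 = lform ?Y X" using X ex by simp
  also have "\<dots> = (2 * \<alpha> - T) / 4 * \<alpha> + (2 * \<beta> - T) / 4 * \<beta> + (2 * \<gamma> - T) / 4 * \<gamma> + (2 * t - T) / 4 * t"
    by (simp only: lform_linear) (simp add: d lform_commute)
  finally have q: "4 = 2 * (\<alpha>\<^sup>2 + \<beta>\<^sup>2 + \<gamma>\<^sup>2 + t\<^sup>2) - T\<^sup>2"
    by (simp add: T power2_eq_square field_simps)
  have signs: "\<alpha> = 1 \<or> \<alpha> = -1" "\<beta> = 1 \<or> \<beta> = -1" "\<gamma> = 1 \<or> \<gamma> = -1"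
    using assms(3-5) by (auto simp: d)
  define e where "e = \<alpha> + \<beta> + \<gamma>"
  have "\<alpha>\<^sup>2 = 1" "\<beta>\<^sup>2 = 1" "\<gamma>\<^sup>2 = 1" using signs by auto
  then have q': "(t - e)\<^sup>2 = 2 * e\<^sup>2 - 2"
    using q by (simp add: T e_def power2_eq_square algebra_simps)
  show ?thesis
  \<comment> \<open>The sum \<open>e\<close> of three signs is \<open>3\<close> or \<open>-3\<close>
    if they agree, and \<open>1\<close> or \<open>-1\<close> otherwise. Agreement gives
    \<open>t = e + 4\<close> or \<open>t = e - 4\<close>: up to sign, \<open>D\<close> and its
    reflection.\<close>
  proof (cases "e\<^sup>2 = 9")
    case True
    then have "\<bar>t - e\<bar> = \<bar>4\<bar>" using q' by (subst abs_eq_iff) (auto simp: power2_eq_iff[of _ 4, simplified])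
    then have t: "t = e + 4 \<or> t = e - 4" by auto
    have "\<alpha> = 1 \<and> \<beta> = 1 \<and> \<gamma> = 1 \<or> \<alpha> = -1 \<and> \<beta> = -1 \<and> \<gamma> = -1"
      using signs True by (auto simp: e_def)
    then consider "\<alpha> = 1" "\<beta> = 1" "\<gamma> = 1" "t = 7" | "\<alpha> = 1" "\<beta> = 1" "\<gamma> = 1" "t = -1"
      | "\<alpha> = -1" "\<beta> = -1" "\<gamma> = -1" "t = 1" | "\<alpha> = -1" "\<beta> = -1" "\<gamma> = -1" "t = -7"
      using t by (auto simp: e_def)
    then have "X = D \<or> X = - D \<or> X = 2 *\<^sub>R (A + B + C) - D \<or> X = - (2 *\<^sub>R (A + B + C) - D)"
      by cases (use ex in \<open>simp_all add: T scaleR_add_right\<close>)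
    then show ?thesis by auto
  next
    case False
    \<comment> \<open>One sign differs from the other two; the quadratic then has the double root
      \<open>t = e\<close>, and \<open>X\<close> is, up to sign, the frame vector with the odd
      sign.\<close>
    then have e: "e = 1 \<or> e = -1" using signs by (auto simp: e_def)
    then have "t = e" using q' by auto
    then have "X \<in> {A, B, C} \<or> - X \<in> {A, B, C}"
      using ex e signs by (auto simp: T e_def)
    then show ?thesis by auto
  qed
qed

section \<open>Tangency of oriented circles\<close>

definition circle_vector :: "real \<times> real \<Rightarrow> real \<Rightarrow> real \<times> (real \<times> real) \<times> real" where
  "circle_vector z \<rho> = (1 / \<rho>, (1 / \<rho>) *\<^sub>R z, ((norm z)\<^sup>2 - \<rho>\<^sup>2) / \<rho>)"

lemma circle_vector_uminus: "circle_vector z (- \<rho>) = - circle_vector z \<rho>"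
  by (simp add: circle_vector_def)

lemma circle_vector_eq_iff:
  assumes "\<rho> \<noteq> 0" "\<rho>' \<noteq> 0"
  shows "circle_vector z \<rho> = circle_vector z' \<rho>' \<longleftrightarrow> z = z' \<and> \<rho> = \<rho>'"
  using assms by (auto simp: circle_vector_def)

text \<open>Law of cosines: for intersecting circles of positive radii the product is the cosine of
  the angle between the radii at a common point.\<close>

lemma lform_circle_vector:
  assumes "\<rho> \<noteq> 0" "\<rho>' \<noteq> 0"
  shows "lform (circle_vector z \<rho>) (circle_vector z' \<rho>') = (\<rho>\<^sup>2 + \<rho>'\<^sup>2 - (dist z z')\<^sup>2) / (2 * \<rho> * \<rho>')"
proof -
  have "(dist z z')\<^sup>2 = (norm z)\<^sup>2 + (norm z')\<^sup>2 - 2 * (z \<bullet> z')"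
    by (simp add: dist_norm power2_norm_eq_inner inner_diff_left inner_diff_right inner_commute)
  then show ?thesis
    using assms by (simp add: lform_def circle_vector_def) (simp add: field_simps power2_eq_square)
qed

lemma lform_circle_vector_self:
  assumes "\<rho> \<noteq> 0"
  shows "lform (circle_vector z \<rho>) (circle_vector z \<rho>) = 1"
  using assms by (simp add: lform_circle_vector power2_eq_square)

text \<open>Signed radii merge both kinds of tangency into one condition: equal signs give external
  tangency, opposite signs internal tangency. If \<open>\<rho> + \<rho>' = 0\<close>, the condition
  describes one circle with both orientations.\<close>

lemma lform_circle_vector_eq_minus_one_iff:
  assumes "\<rho> \<noteq> 0" "\<rho>' \<noteq> 0"
  shows "lform (circle_vector z \<rho>) (circle_vector z' \<rho>') = -1 \<longleftrightarrow> (dist z z')\<^sup>2 = (\<rho> + \<rho>')\<^sup>2"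
  using assms by (auto simp: lform_circle_vector field_simps power2_eq_square)

text \<open>Mirroring the common point in the line of centres gives a common point again, so by
  uniqueness it lies on that line; the distance of the centres is then the sum or the difference of
  the radii.\<close>

lemma tangentD:
  assumes "tangent C D"
  shows "radius C > 0" "radius D > 0" "center C \<noteq> center D"
    "(dist (center C) (center D))\<^sup>2 = (radius C + radius D)\<^sup>2
      \<or> (dist (center C) (center D))\<^sup>2 = (radius C - radius D)\<^sup>2"
proof -
  show pos: "radius C > 0" "radius D > 0" using assms by (auto simp: tangent_def)
  obtain p where p: "p \<in> points C" "p \<in> points D"
    and uniq: "\<And>q. q \<in> points C \<Longrightarrow> q \<in> points D \<Longrightarrow> q = p"
    using assms unfolding tangent_def by blast
  obtain x y where zC: "center C = (x, y)" by (rule prod.exhaust)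
  obtain x' y' where zD: "center D = (x', y')" by (rule prod.exhaust)
  obtain u v where puv: "p = (u, v)" by (rule prod.exhaust)
  have on: "(s, t) \<in> points C \<longleftrightarrow> (x - s)\<^sup>2 + (y - t)\<^sup>2 = (radius C)\<^sup>2"
    "(s, t) \<in> points D \<longleftrightarrow> (x' - s)\<^sup>2 + (y' - t)\<^sup>2 = (radius D)\<^sup>2" for s t
  proof -
    have "p \<in> points K \<longleftrightarrow> (dist (center K) p)\<^sup>2 = (radius K)\<^sup>2" if "radius K > 0" for K p
      using that by (simp add: points_def power2_eq_iff_nonneg)
    note this[OF pos(1), of "(s, t)"] this[OF pos(2), of "(s, t)"]
    moreover have "(dist (v, w) (s, t))\<^sup>2 = (v - s)\<^sup>2 + (w - t)\<^sup>2" for v w :: real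
      by (simp add: dist_Pair_Pair dist_real_def)
    ultimately show "(s, t) \<in> points C \<longleftrightarrow> (x - s)\<^sup>2 + (y - t)\<^sup>2 = (radius C)\<^sup>2"
      "(s, t) \<in> points D \<longleftrightarrow> (x' - s)\<^sup>2 + (y' - t)\<^sup>2 = (radius D)\<^sup>2"
      unfolding zC zD by metis+
  qed
  have pC: "(x - u)\<^sup>2 + (y - v)\<^sup>2 = (radius C)\<^sup>2" and pD: "(x' - u)\<^sup>2 + (y' - v)\<^sup>2 = (radius D)\<^sup>2"
    using p on puv by auto
  show ne: "center C \<noteq> center D"
  proof
    assume e: "center C = center D"
    \<comment> \<open>For concentric circles the antipode of \<open>p\<close> is a common point too,
      which would force radius 0.\<close>
    have "(2 * x - u, 2 * y - v) \<in> points C \<inter> points D"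
      using pC pD e by (auto simp: on zC zD power2_eq_square algebra_simps)
    then have "2 * x - u = u \<and> 2 * y - v = v" using uniq puv by blast
    then have "(radius C)\<^sup>2 = 0" using pC by auto
    then show False using pos by simp
  qed
  define X Y where XY: "X = x' - x" "Y = y' - y"
  define N where N: "N = X\<^sup>2 + Y\<^sup>2"
  have Npos: "N > 0" using ne by (auto simp: N XY zC zD sum_power2_gt_zero_iff)
  \<comment> \<open>\<open>h * (-Y, X)\<close> is the component of \<open>p - center C\<close>
    normal to the line of centres, so subtracting it twice mirrors \<open>p\<close>.\<close>
  define h where h: "h = (X * (v - y) - Y * (u - x)) / N"
  have hN: "h * N = X * (v - y) - Y * (u - x)" using Npos by (simp add: h)
  have "(u + 2 * h * Y, v - 2 * h * X) \<in> points C \<inter> points D"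
  proof -
    have "(x - (u + 2 * h * Y))\<^sup>2 + (y - (v - 2 * h * X))\<^sup>2
      = (x - u)\<^sup>2 + (y - v)\<^sup>2 + 4 * h * (h * N - (X * (v - y) - Y * (u - x)))"
      by (simp add: N power2_eq_square algebra_simps)
    moreover have "(x' - (u + 2 * h * Y))\<^sup>2 + (y' - (v - 2 * h * X))\<^sup>2
      = (x' - u)\<^sup>2 + (y' - v)\<^sup>2 + 4 * h * (h * N - (X * (v - y) - Y * (u - x)))"
      by (simp add: N XY power2_eq_square algebra_simps)
    ultimately show ?thesis using pC pD by (simp add: on hN)
  qed
  then have "(u + 2 * h * Y, v - 2 * h * X) = (u, v)" using uniq puv by blast
  then have "h * X = 0" "h * Y = 0" by simp_all
  then have "h = 0" using Npos by (auto simp: N)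
  then have cross: "X * (v - y) = Y * (u - x)" using hN by simp
  define I where I: "I = X * (u - x) + Y * (v - y)"
  \<comment> \<open>Lagrange's identity; the cross product vanishes because \<open>p\<close> is on
    the line of centres.\<close>
  have "I\<^sup>2 = N * (radius C)\<^sup>2 - (X * (v - y) - Y * (u - x))\<^sup>2"
    unfolding pC[symmetric] N I by (simp add: power2_eq_square algebra_simps)
  then have I2: "I\<^sup>2 = N * (radius C)\<^sup>2" unfolding cross by simp
  have "(radius D)\<^sup>2 = (radius C)\<^sup>2 - 2 * I + N"
    unfolding pC[symmetric] pD[symmetric] N I XY by (simp add: power2_eq_square algebra_simps)
  then have "2 * I = (radius C)\<^sup>2 + N - (radius D)\<^sup>2" by linarith
  moreover have "(2 * I)\<^sup>2 = 4 * N * (radius C)\<^sup>2" unfolding power_mult_distrib I2 by simp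
  ultimately have "((radius C)\<^sup>2 + N - (radius D)\<^sup>2)\<^sup>2 = 4 * N * (radius C)\<^sup>2" by metis
  \<comment> \<open>Heron's factorization: the triangle formed by the centres and \<open>p\<close>
    has area zero.\<close>
  moreover have "(N - (radius C + radius D)\<^sup>2) * (N - (radius C - radius D)\<^sup>2)
    = ((radius C)\<^sup>2 + N - (radius D)\<^sup>2)\<^sup>2 - 4 * N * (radius C)\<^sup>2"
    by (simp add: power2_eq_square algebra_simps)
  ultimately have "(N - (radius C + radius D)\<^sup>2) * (N - (radius C - radius D)\<^sup>2) = 0"
    by linarith
  moreover have "(dist (center C) (center D))\<^sup>2 = N"
    by (simp add: zC zD dist_Pair_Pair dist_real_def N XY power2_commute)
  ultimately show "(dist (center C) (center D))\<^sup>2 = (radius C + radius D)\<^sup>2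
      \<or> (dist (center C) (center D))\<^sup>2 = (radius C - radius D)\<^sup>2"
    by (metis eq_iff_diff_eq_0 mult_eq_0_iff)
qed

text \<open>The vectors \<open>e = p - z\<close> and \<open>f = p - z'\<close> have inner product
  \<open>- \<rho> * \<rho>'\<close>, the equality case of Cauchy-Schwarz. Hence
  \<open>\<rho>' *\<^sub>R e + \<rho> *\<^sub>R f\<close> has norm zero, which determines
  \<open>p\<close>.\<close>

lemma common_point_of_oriented_circles:
  fixes z z' :: "'a :: real_inner"
  assumes "(dist z z')\<^sup>2 = (\<rho> + \<rho>')\<^sup>2" "\<rho> + \<rho>' \<noteq> 0"
  shows "dist z p = \<bar>\<rho>\<bar> \<and> dist z' p = \<bar>\<rho>'\<bar> \<longleftrightarrow> p = (1 / (\<rho> + \<rho>')) *\<^sub>R (\<rho>' *\<^sub>R z + \<rho> *\<^sub>R z')"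
    (is "?L \<longleftrightarrow> p = ?q")
proof
  assume ?L
  define e f where ef: "e = p - z" "f = p - z'"
  have e: "e \<bullet> e = \<rho>\<^sup>2" and f: "f \<bullet> f = \<rho>'\<^sup>2"
    using \<open>?L\<close> by (simp_all add: ef dist_norm norm_minus_commute flip: power2_norm_eq_inner)
  have zz: "z - z' = f - e" by (simp add: ef)
  have "(f - e) \<bullet> (f - e) = (\<rho> + \<rho>')\<^sup>2"
    using assms(1) by (simp add: dist_norm zz flip: power2_norm_eq_inner)
  then have ip: "e \<bullet> f = - \<rho> * \<rho>'"
    using e f by (simp add: inner_diff_left inner_diff_right inner_commute power2_eq_square algebra_simps)
  have "(\<rho>' *\<^sub>R e + \<rho> *\<^sub>R f) \<bullet> (\<rho>' *\<^sub>R e + \<rho> *\<^sub>R f)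
    = \<rho>' * \<rho>' * (e \<bullet> e) + 2 * \<rho> * \<rho>' * (e \<bullet> f) + \<rho> * \<rho> * (f \<bullet> f)"
    by (simp add: inner_add_left inner_add_right inner_commute algebra_simps)
  also have "\<dots> = 0" unfolding e f ip by (simp add: power2_eq_square algebra_simps)
  finally have "\<rho>' *\<^sub>R e + \<rho> *\<^sub>R f = 0" by simp
  then have "(\<rho> + \<rho>') *\<^sub>R p = \<rho>' *\<^sub>R z + \<rho> *\<^sub>R z'" by (simp add: ef algebra_simps)
  then have "(1 / (\<rho> + \<rho>')) *\<^sub>R ((\<rho> + \<rho>') *\<^sub>R p) = ?q" by (simp only:)
  then show "p = ?q" using assms(2) by simp
next
  assume p: "p = ?q"
  have d: "dist z z' = \<bar>\<rho> + \<rho>'\<bar>"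
    using assms(1) by (metis abs_ge_zero power2_abs power2_eq_imp_eq zero_le_dist)
  have "z - p = (1 / (\<rho> + \<rho>')) *\<^sub>R ((\<rho> + \<rho>') *\<^sub>R z - (\<rho>' *\<^sub>R z + \<rho> *\<^sub>R z'))"
    "z' - p = (1 / (\<rho> + \<rho>')) *\<^sub>R ((\<rho> + \<rho>') *\<^sub>R z' - (\<rho>' *\<^sub>R z + \<rho> *\<^sub>R z'))"
    unfolding scaleR_right_diff_distrib using assms(2) by (simp_all only: p) simp_all
  then have "z - p = (\<rho> / (\<rho> + \<rho>')) *\<^sub>R (z - z')" "z' - p = (\<rho>' / (\<rho> + \<rho>')) *\<^sub>R (z' - z)"
    by (simp_all add: algebra_simps)
  then show ?L using d assms(2) by (simp add: dist_norm norm_minus_commute abs_divide)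
qed

text \<open>Converse to \<open>tangentD\<close>. The explicit tangency point serves to show that the
  six tangency points are distinct.\<close>

lemma oriented_tangency:
  assumes "radius C = \<bar>\<rho>\<bar>" "radius D = \<bar>\<rho>'\<bar>" "\<rho> \<noteq> 0" "\<rho>' \<noteq> 0" "\<rho> + \<rho>' \<noteq> 0"
    "(dist (center C) (center D))\<^sup>2 = (\<rho> + \<rho>')\<^sup>2"
  shows "tangent C D"
    and "tangency_point C D = (1 / (\<rho> + \<rho>')) *\<^sub>R (\<rho>' *\<^sub>R center C + \<rho> *\<^sub>R center D)"
proof -
  have "p \<in> points C \<inter> points D \<longleftrightarrow>
      p = (1 / (\<rho> + \<rho>')) *\<^sub>R (\<rho>' *\<^sub>R center C + \<rho> *\<^sub>R center D)" for p
    using common_point_of_oriented_circles[OF assms(6,5), of p] assms(1,2) by (simp add: points_def)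
  then show "tangent C D"
    and "tangency_point C D = (1 / (\<rho> + \<rho>')) *\<^sub>R (\<rho>' *\<^sub>R center C + \<rho> *\<^sub>R center D)"
    using assms by (simp_all add: tangent_def tangency_point_def)
qed

section \<open>Integrality of the packing\<close>

text \<open>\<open>\<rho> i\<close> is the reciprocal of the oriented curvature of the \<open>i\<close>-th circle.\<close>

definition integral_quadruple :: "circle list \<Rightarrow> (nat \<Rightarrow> real) \<Rightarrow> bool" where
  "integral_quadruple Q \<rho> \<longleftrightarrow> length Q = 4 \<and>
     (\<forall>i<4. radius (Q ! i) = \<bar>\<rho> i\<bar> \<and> \<rho> i \<noteq> 0 \<and> 1 / \<rho> i \<in> \<int>) \<and>
     (\<forall>i<4. \<forall>j<4. i \<noteq> j \<longrightarrow> (dist (center (Q ! i)) (center (Q ! j)))\<^sup>2 = (\<rho> i + \<rho> j)\<^sup>2)"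

lemma all_less_4_iff: "(\<forall>i<4::nat. P i) \<longleftrightarrow> P 0 \<and> P 1 \<and> P 2 \<and> P 3"
  by (auto simp: less_Suc_eq numeral_eq_Suc)

text \<open>Some orientation of the new circle has the vector
  \<open>2 *\<^sub>R (A + B + C) - D\<close>, once the four old vectors are excluded. Its first
  component is an integer combination of integer curvatures.\<close>

lemma integral_quadruple_reflection:
  assumes Q: "integral_quadruple Q \<rho>" and "descartes_reflection Q Q'"
  shows "\<exists>\<rho>'. integral_quadruple Q' \<rho>'"
proof -
  note q = Q[unfolded integral_quadruple_def]
  obtain i E where i: "i < 4" and E: "E \<noteq> Q ! i" "\<And>j. j < 4 \<Longrightarrow> j \<noteq> i \<Longrightarrow> tangent E (Q ! j)"
    and Q': "Q' = Q[i := E]"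
    using assms(2) q by (auto simp: descartes_reflection_def)
  define v where "v j = circle_vector (center (Q ! j)) (\<rho> j)" for j
  define X where "X = circle_vector (center E) (radius E)"
  have "\<exists>j k l. j < 4 \<and> k < 4 \<and> l < 4 \<and> distinct [i, j, k, l] \<and> (\<forall>m<4. m \<in> {i, j, k, l})"
  proof -
    consider "i = 0" | "i = 1" | "i = 2" | "i = 3" using i by linarith
    then show ?thesis
    proof cases
      case 1 then show ?thesis by (intro exI[of _ 1] exI[of _ 2] exI[of _ 3]) (simp add: all_less_4_iff)
    next
      case 2 then show ?thesis by (intro exI[of _ 0] exI[of _ 2] exI[of _ 3]) (simp add: all_less_4_iff)
    next
      case 3 then show ?thesis by (intro exI[of _ 0] exI[of _ 1] exI[of _ 3]) (simp add: all_less_4_iff)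
    next
      case 4 then show ?thesis by (intro exI[of _ 0] exI[of _ 1] exI[of _ 2]) (simp add: all_less_4_iff)
    qed
  qed
  then obtain j k l where jkl: "j < 4" "k < 4" "l < 4" "distinct [i, j, k, l]" "\<forall>m<4. m \<in> {i, j, k, l}" by blast
  have idx: "m \<in> {j, k, l}" if "m < 4" "m \<noteq> i" for m
    using that jkl(5) by auto
  have vv: "lform (v m) (v m) = 1" if "m < 4" for m
    using that q by (simp add: v_def lform_circle_vector_self)
  have vw: "lform (v m) (v n) = -1" if "m < 4" "n < 4" "m \<noteq> n" for m n
    using that q by (simp add: v_def lform_circle_vector_eq_minus_one_iff)
  \<comment> \<open>The replaced circle comes last, as the vector whose product with
    \<open>X\<close> is unknown.\<close>
  have frame: "descartes_frame (v j) (v k) (v l) (v i)"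
    using i jkl by (simp add: descartes_frame_def vv vw)
  have r: "radius E > 0" using tangentD(1)[OF E(2)[of j]] jkl by auto
  have XX: "lform X X = 1" using r by (simp add: X_def lform_circle_vector_self)
  have Xv: "lform X (v m) \<in> {1, -1}" if "m < 4" "m \<noteq> i" for m
  proof -
    have \<rho>: "radius (Q ! m) = \<bar>\<rho> m\<bar>" "\<rho> m \<noteq> 0" using q that by auto
    \<comment> \<open>The two kinds of tangency, relative to the sign of \<open>\<rho> m\<close>,
      become the two orientations of \<open>E\<close>.\<close>
    have "(dist (center E) (center (Q ! m)))\<^sup>2 = (radius E + \<rho> m)\<^sup>2 \<or>
      (dist (center E) (center (Q ! m)))\<^sup>2 = (- radius E + \<rho> m)\<^sup>2"
      using tangentD(4)[OF E(2)[OF that]] \<rho> by (auto simp: abs_if power2_commute add.commute split: if_splits)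
    then have "lform X (v m) = -1 \<or> lform (- X) (v m) = -1"
      using lform_circle_vector_eq_minus_one_iff[of "radius E" "\<rho> m"]
        lform_circle_vector_eq_minus_one_iff[of "- radius E" "\<rho> m"] r \<rho>
      by (simp add: X_def v_def flip: circle_vector_uminus)
    then show ?thesis using lform_scaleR_left[of "-1" X "v m"] by auto
  qed
  obtain s where s: "s \<in> {1, -1}" and
    sX: "s *\<^sub>R X \<in> {v j, v k, v l, v i, 2 *\<^sub>R (v j + v k + v l) - v i}"
  proof -
    have "j \<noteq> i" "k \<noteq> i" "l \<noteq> i" using jkl(4) by auto
    from descartes_frame_tangent_cases[OF frame XX Xv[OF jkl(1) this(1)] Xv[OF jkl(2) this(2)]
        Xv[OF jkl(3) this(3)]]
    show ?thesis using that by blast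
  qed
  have sXv: "s *\<^sub>R X = circle_vector (center E) (s * radius E)"
    using s by (auto simp: X_def circle_vector_uminus)
  have sr: "s * radius E \<noteq> 0" "\<bar>s * radius E\<bar> = radius E" using s r by auto
  have eq: "center E = center (Q ! m) \<and> s * radius E = \<rho> m" if "s *\<^sub>R X = v m" "m < 4" for m
    using that q sr by (simp add: sXv v_def circle_vector_eq_iff)
  \<comment> \<open>Equality would make \<open>E\<close> concentric with a circle tangent to
    it.\<close>
  have "s *\<^sub>R X \<noteq> v m" if "m < 4" "m \<noteq> i" for m
    using eq[of m] tangentD(3)[OF E(2)[OF that]] that by auto
  moreover have "s *\<^sub>R X \<noteq> v i"
    using eq[of i] E(1) q i sr by (metis circle.expand)
  ultimately have R: "s *\<^sub>R X = 2 *\<^sub>R (v j + v k + v l) - v i"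
    using sX jkl by auto
  have "fst (s *\<^sub>R X) = 2 * (1 / \<rho> j + 1 / \<rho> k + 1 / \<rho> l) - 1 / \<rho> i"
    unfolding R by (simp add: v_def circle_vector_def)
  moreover have "\<dots> \<in> \<int>"
    using q i jkl(1-3) by (intro Ints_diff Ints_mult Ints_add Ints_numeral) auto
  ultimately have int: "1 / (s * radius E) \<in> \<int>"
    by (simp add: sXv) (simp add: circle_vector_def)
  \<comment> \<open>The product is \<open>2 * (1 - 1 - 1) + 1\<close>, so a single orientation of
    \<open>E\<close> is tangent to all three kept circles.\<close>
  have "lform (s *\<^sub>R X) (v m) = -1" if "m < 4" "m \<noteq> i" for m
    using idx[OF that] i jkl unfolding R by (auto simp: lform_linear vv vw)
  then have dE: "(dist (center E) (center (Q ! m)))\<^sup>2 = (s * radius E + \<rho> m)\<^sup>2" if "m < 4" "m \<noteq> i" for m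
    using that q sr by (simp add: sXv v_def lform_circle_vector_eq_minus_one_iff)
  have "integral_quadruple Q' (\<rho>(i := s * radius E))"
    using q i sr int dE
    by (auto simp: integral_quadruple_def Q' nth_list_update dist_commute add.commute)
  then show ?thesis by blast
qed

text \<open>The invariant passes along any chain of reflections. Both \<open>1 / \<rho> i\<close>
  and the oriented curvature equal \<open>1 / radius C\<close> up to sign, so integrality carries
  over whichever circle encloses the packing.\<close>

lemma integral_quadruple_imp_integral_packing:
  assumes "integral_quadruple Q \<rho>"
  shows "integral_packing (apollonian_packing Q)"
  unfolding integral_packing_def
proof
  fix C assume "C \<in> apollonian_packing Q"
  then obtain Q' where r: "descartes_reflection\<^sup>*\<^sup>* Q Q'" and C: "C \<in> set Q'"
    by (auto simp: apollonian_packing_def)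
  from r have "\<exists>\<rho>. integral_quadruple Q' \<rho>"
    by induction (use assms integral_quadruple_reflection in blast)+
  then obtain \<rho> i where "i < 4" "C = Q' ! i" "radius C = \<bar>\<rho> i\<bar>" "1 / \<rho> i \<in> \<int>"
    using C unfolding integral_quadruple_def by (metis in_set_conv_nth)
  then have "1 / radius C \<in> \<int>"
    by (cases "\<rho> i \<ge> 0") (auto simp: abs_if)
  then show "oriented_curvature (apollonian_packing Q) C \<in> \<int>"
    by (simp add: oriented_curvature_def)
qed

section \<open>The Pythagorean configuration\<close>

lemma pairs_less_4: "{(i, j). i < j \<and> j < (4::nat)} = {(0,1), (0,2), (0,3), (1,2), (1,3), (2,3)}"
  by (auto simp: less_Suc_eq numeral_eq_Suc)

lemma encloses_iff:
  assumes "radius D \<ge> 0"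
  shows "encloses C D \<longleftrightarrow> dist (center C) (center D) + radius D \<le> radius C"
  using assms by (auto simp: encloses_def cball_subset_cball_iff dist_commute)

theorem mainTheorem8:
  fixes a b c :: int
    and G r1 r2 r3 r4 :: real
    and C1 C2 C3 C4 :: circle
  assumes triple: "primitive_pythagorean_triple a b c"
    and G: "G = 1 / 2 * (real_of_int a * real_of_int b)"
    and r1: "r1 = 1 / 2 * (real_of_int a + real_of_int b - real_of_int c)"
    and r2: "r2 = 1 / 2 * (real_of_int a - real_of_int b + real_of_int c)"
    and r3: "r3 = 1 / 2 * (- real_of_int a + real_of_int b + real_of_int c)"
    and r4: "r4 = 1 / 2 * (real_of_int a + real_of_int b + real_of_int c)"
    and C1: "C1 = Circle (0, 0) (r1 / G)"
    and C2: "C2 = Circle (real_of_int a / G, 0) (r2 / G)"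
    and C3: "C3 = Circle (0, real_of_int b / G) (r3 / G)"
    and C4: "C4 = Circle (real_of_int a / G, real_of_int b / G) (r4 / G)"
  shows
    "is_rectangle (center C1) (center C2) (center C4) (center C3) \<and>
     dist (center C1) (center C2) = real_of_int a / G \<and>
     dist (center C1) (center C3) = real_of_int b / G \<and>
     descartes_quadruple [C1, C2, C3, C4] \<and>
     encloses C4 C1 \<and> encloses C4 C2 \<and> encloses C4 C3 \<and>
     oriented_curvature {C1, C2, C3, C4} C1 = r4 \<and>
     oriented_curvature {C1, C2, C3, C4} C2 = r3 \<and>
     oriented_curvature {C1, C2, C3, C4} C3 = r2 \<and>
     oriented_curvature {C1, C2, C3, C4} C4 = - r1 \<and>
     (\<exists>k1 k2 k3 k4 :: int.
        real_of_int k1 = r4 \<and> real_of_int k2 = r3 \<and>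
        real_of_int k3 = r2 \<and> real_of_int k4 = - r1 \<and>
        Gcd {k1, k2, k3, k4} = 1) \<and>
     descartes_equation r4 r3 r2 (- r1) \<and>
     integral_packing (apollonian_packing [C1, C2, C3, C4]) \<and>
     (\<exists>D1 D2 D3 D4.
        {D1, D2, D3, D4} \<subseteq> apollonian_packing [C1, C2, C3, C4] \<and>
        is_rectangle (center D1) (center D2) (center D3) (center D4))"
proof -

  \<comment> \<open>Relations between sides and radii\<close>
  define x y z where xyz: "x = real_of_int a" "y = real_of_int b" "z = real_of_int c"
  have abc: "a > 0" "b > 0" "c > 0" "a\<^sup>2 + b\<^sup>2 = c\<^sup>2" and gcd: "Gcd {a, b, c} = 1"
    using triple by (auto simp: primitive_pythagorean_triple_def)
  have pos: "x > 0" "y > 0" "z > 0" using abc by (auto simp: xyz)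
  have pyth: "x\<^sup>2 + y\<^sup>2 = z\<^sup>2"
    using abc(4) unfolding xyz by (metis of_int_add of_int_power)
  \<comment> \<open>These make \<open>r3\<close>, \<open>r2\<close> and \<open>r1\<close> positive,
    in this order.\<close>
  have lt: "x < z" "y < z" "z < x + y"
  proof -
    show "x < z" by (rule power2_less_imp_less) (use pyth pos in \<open>auto simp: pyth[symmetric]\<close>)
    show "y < z" by (rule power2_less_imp_less) (use pyth pos in \<open>auto simp: pyth[symmetric]\<close>)
    show "z < x + y"
      by (rule power2_less_imp_less) (use pos in \<open>auto simp: pyth[symmetric] power2_sum\<close>)
  qed
  note r = r1[folded xyz] r2[folded xyz] r3[folded xyz] r4[folded xyz]
  have rpos: "r1 > 0" "r2 > 0" "r3 > 0" "r4 > 0" using lt pos by (auto simp: r)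
  have Gpos: "G > 0" using pos by (simp add: G xyz)
  \<comment> \<open>Two forms of the area of a right triangle. Scaling by \<open>1 / G\<close>
    therefore turns the radii \<open>r1\<close>, \<open>r2\<close>, \<open>r3\<close>,
    \<open>r4\<close> into the curvatures \<open>r4\<close>, \<open>r3\<close>, \<open>r2\<close>,
    \<open>r1\<close>.\<close>
  have prod: "r1 * r4 = G" "r2 * r3 = G"
    using pyth by (simp_all add: r G[folded xyz] power2_eq_square field_simps)
  \<comment> \<open>One identity per pair of circles: \<open>x\<close> and \<open>y\<close> are the
    sides and \<open>z\<close> the diagonal of the rectangle, scaled by \<open>G\<close>.\<close>
  have rsum: "r1 + r2 = x" "r1 + r3 = y" "r2 + r3 = z" "r4 - r1 = z" "r4 - r2 = y" "r4 - r3 = x"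
    by (simp_all add: r field_simps)
  have inv: "1 / (r1 / G) = r4" "1 / (r2 / G) = r3" "1 / (r3 / G) = r2" "1 / (r4 / G) = r1"
    using rpos by (simp_all add: prod(1)[symmetric] field_simps) (simp_all add: prod)
  note C = C1[folded xyz] C2[folded xyz] C3[folded xyz] C4[folded xyz]

  \<comment> \<open>Integrality and greatest common divisor of the curvatures\<close>
  obtain m where m: "a + b + c = 2 * m"
  proof -
    \<comment> \<open>A square has the parity of its root, so the semiperimeter \<open>m\<close> is
      an integer.\<close>
    have "even (a\<^sup>2 + b\<^sup>2) \<longleftrightarrow> even (c\<^sup>2)" using abc by simp
    then have "even (a + b + c)" by simp
    then show ?thesis using that by (meson evenE)
  qed
  have "x + y + z = 2 * real_of_int m"
    unfolding xyz using m by (metis of_int_add of_int_mult of_int_numeral)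
  then have k: "real_of_int m = r4" "real_of_int (m - a) = r3" "real_of_int (m - b) = r2"
    "real_of_int (c - m) = - r1"
    unfolding of_int_diff xyz[symmetric] by (simp_all add: r field_simps)
  \<comment> \<open>Each of \<open>a\<close>, \<open>b\<close>, \<open>c\<close> is a sum or
    difference of two curvatures, so a common divisor of the curvatures divides the triple.\<close>
  have "Gcd {m, m - a, m - b, c - m} dvd d" if "d \<in> {a, b, c}" for d
  proof -
    have g: "Gcd {m, m - a, m - b, c - m} dvd e" if "e \<in> {m, m - a, m - b, c - m}" for e
      using that by (rule Gcd_dvd)
    have "d \<in> {m - (m - a), m - (m - b), m + (c - m)}" using that by auto
    moreover note dvd_diff[OF g g, of m "m - a"] dvd_diff[OF g g, of m "m - b"]
      dvd_add[OF g g, of m "c - m"]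
    ultimately show ?thesis by (metis insert_iff empty_iff)
  qed
  then have "Gcd {m, m - a, m - b, c - m} dvd Gcd {a, b, c}" by (rule Gcd_greatest)
  then have gcd': "Gcd {m, m - a, m - b, c - m} = 1" 
    by (metis gcd zdvd1_eq abs_of_nonneg Gcd_int_greater_eq_0)

  \<comment> \<open>Signed radii and mutual tangency\<close>
  \<comment> \<open>The minus sign at \<open>r4\<close> marks the enclosing circle, whose three
    tangencies are internal.\<close>
  define \<rho> where "\<rho> = (!) [r1 / G, r2 / G, r3 / G, - r4 / G]"
  have \<rho>: "\<rho> 0 = r1 / G" "\<rho> 1 = r2 / G" "\<rho> (Suc 0) = r2 / G" "\<rho> 2 = r3 / G" "\<rho> 3 = - r4 / G"
    by (simp_all add: \<rho>_def)
  have dist_sq: "(dist (x1 / G, y1 / G) (x2 / G, y2 / G))\<^sup>2 = (s / G)\<^sup>2"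
    if "(x1 - x2)\<^sup>2 + (y1 - y2)\<^sup>2 = s\<^sup>2" for x1 y1 x2 y2 s
    using that Gpos
    by (simp add: dist_Pair_Pair dist_real_def flip: diff_divide_distrib)
       (simp add: power_divide flip: add_divide_distrib)
  have d: "(dist (center C1) (center C2))\<^sup>2 = (r1 / G + r2 / G)\<^sup>2"
    "(dist (center C1) (center C3))\<^sup>2 = (r1 / G + r3 / G)\<^sup>2"
    "(dist (center C1) (center C4))\<^sup>2 = (r1 / G + - r4 / G)\<^sup>2"
    "(dist (center C2) (center C3))\<^sup>2 = (r2 / G + r3 / G)\<^sup>2"
    "(dist (center C2) (center C4))\<^sup>2 = (r2 / G + - r4 / G)\<^sup>2"
    "(dist (center C3) (center C4))\<^sup>2 = (r3 / G + - r4 / G)\<^sup>2"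
    unfolding C circle.sel add_divide_distrib[symmetric]
    using dist_sq[of 0 x 0 0 "r1 + r2"] dist_sq[of 0 0 0 y "r1 + r3"] dist_sq[of 0 x 0 y "r1 + - r4"]
      dist_sq[of x 0 0 y "r2 + r3"] dist_sq[of x x 0 y "r2 + - r4"] dist_sq[of 0 x y y "r3 + - r4"]
      pyth rsum by (simp_all add: r power2_eq_square field_simps)
  have iq: "integral_quadruple [C1, C2, C3, C4] \<rho>"
  proof -
    have "r1 \<in> \<int>" "r2 \<in> \<int>" "r3 \<in> \<int>" "r4 \<in> \<int>"
      using k by (metis Ints_of_int Ints_minus minus_minus)+
    moreover have "1 / (- r4 / G) = - r1" using inv(4) by simp
    ultimately have "\<forall>i<4. radius ([C1, C2, C3, C4] ! i) = \<bar>\<rho> i\<bar> \<and> \<rho> i \<noteq> 0 \<and> 1 / \<rho> i \<in> \<int>"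
      unfolding all_less_4_iff \<rho> inv using rpos Gpos by (simp add: C)
    then show ?thesis
      using d by (simp add: integral_quadruple_def all_less_4_iff \<rho> dist_commute add.commute)
  qed
  have \<rho>sum: "\<rho> i + \<rho> j \<noteq> 0" if "i < 4" "j < 4" "i \<noteq> j" for i j
  proof -
    have "\<forall>i<4. \<forall>j<4. i \<noteq> j \<longrightarrow> \<rho> i + \<rho> j \<noteq> 0"
      using rpos rsum pos Gpos unfolding all_less_4_iff \<rho>
      by (simp flip: add_divide_distrib diff_divide_distrib)
    then show ?thesis using that by blast
  qed
  have tan: "tangent ([C1, C2, C3, C4] ! i) ([C1, C2, C3, C4] ! j)"
    and tp: "tangency_point ([C1, C2, C3, C4] ! i) ([C1, C2, C3, C4] ! j) = (1 / (\<rho> i + \<rho> j)) *\<^sub>R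
      (\<rho> j *\<^sub>R center ([C1, C2, C3, C4] ! i) + \<rho> i *\<^sub>R center ([C1, C2, C3, C4] ! j))"
    if "i < 4" "j < 4" "i \<noteq> j" for i j
    using oriented_tangency[of "[C1, C2, C3, C4] ! i" "\<rho> i" "[C1, C2, C3, C4] ! j" "\<rho> j"]
      \<rho>sum[OF that] iq[unfolded integral_quadruple_def] that by blast+

  \<comment> \<open>The six tangency points\<close>
  have tps: "tangency_point C1 C2 = (r1 / G, 0)" "tangency_point C1 C3 = (0, r1 / G)"
    "tangency_point C1 C4 = (- r1 * x / (z * G), - r1 * y / (z * G))"
    "tangency_point C2 C3 = (r3 * x / (z * G), r2 * y / (z * G))"
    "tangency_point C2 C4 = (x / G, - r2 / G)"
    "tangency_point C3 C4 = (- r3 / G, y / G)"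
  proof -
    \<comment> \<open>The weighted mean in coordinates, with one of the common factors
      \<open>1 / G\<close> cancelled.\<close>
    have tp': "p = ((s' * x1 + s * x2) / (w * G), (s' * y1 + s * y2) / (w * G))"
      if "p = (1 / (\<sigma> + \<sigma>')) *\<^sub>R (\<sigma>' *\<^sub>R P1 + \<sigma> *\<^sub>R P2)" "\<sigma> = s / G" "\<sigma>' = s' / G"
        "P1 = (x1 / G, y1 / G)" "P2 = (x2 / G, y2 / G)" "s + s' = w" "w \<noteq> 0"
      for p P1 P2 :: "real \<times> real" and \<sigma> \<sigma>' s s' x1 y1 x2 y2 w
    proof -
      have "1 / (\<sigma> + \<sigma>') = G / w"
        using that(2,3,6) by (simp flip: add_divide_distrib)
      then show ?thesis using that(1-5,7) Gpos by (simp flip: add_divide_distrib)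
    qed
    show "tangency_point C1 C2 = (r1 / G, 0)"
      using tp'[OF tp[of 0 1], of r1 r2 0 0 x 0 x] rsum pos
      by (simp add: \<rho> C)
    show "tangency_point C1 C3 = (0, r1 / G)"
      using tp'[OF tp[of 0 2], of r1 r3 0 0 0 y y] rsum pos
      by (simp add: \<rho> C)
    show "tangency_point C1 C4 = (- r1 * x / (z * G), - r1 * y / (z * G))"
      using tp'[OF tp[of 0 3], of r1 "- r4" 0 0 x y "- z"] rsum pos
      by (simp add: \<rho> C)
    show "tangency_point C2 C3 = (r3 * x / (z * G), r2 * y / (z * G))"
      using tp'[OF tp[of 1 2], of r2 r3 x 0 0 y z] rsum pos
      by (simp add: \<rho> C)
    have rx: "r2 * x - r4 * x = - (y * x)" "r3 * y - r4 * y = - (x * y)"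
      unfolding left_diff_distrib[symmetric] rsum(5,6)[symmetric] by (simp_all add: algebra_simps)
    show "tangency_point C2 C4 = (x / G, - r2 / G)"
      using tp'[OF tp[of 1 3], of r2 "- r4" x 0 x y "- y"] rsum pos
      by (simp add: \<rho> C rx)
    show "tangency_point C3 C4 = (- r3 / G, y / G)"
      using tp'[OF tp[of 2 3], of r3 "- r4" 0 y x y "- x"] rsum pos
      by (simp add: \<rho> C rx)
  qed
  \<comment> \<open>The six tangency points have pairwise different sign patterns.\<close>
  have sgns: "map (map_prod sgn sgn) [tangency_point C1 C2, tangency_point C1 C3,
      tangency_point C1 C4, tangency_point C2 C3, tangency_point C2 C4, tangency_point C3 C4]
    = [(1, 0), (0, 1), (-1, -1), (1, 1), (1, -1), (-1, 1)]"
    using rpos pos Gpos by (simp add: tps sgn_divide sgn_mult)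
  have quad: "descartes_quadruple [C1, C2, C3, C4]"
    unfolding descartes_quadruple_def pairs_less_4
  proof (intro conjI allI impI)
    show "inj_on (\<lambda>(i, j). tangency_point ([C1, C2, C3, C4] ! i) ([C1, C2, C3, C4] ! j))
        {(0, 1), (0, 2), (0, 3), (1, 2), (1, 3), (2, 3)}"
      by (rule inj_on_imageI2[of "map_prod sgn sgn"]) (use sgns in simp)
  qed (use tan in simp_all)

  \<comment> \<open>Enclosure and orientation\<close>
  have dd: "dist (center C4) (center C1) = z / G" "dist (center C4) (center C2) = y / G"
    "dist (center C4) (center C3) = x / G" "dist (center C1) (center C2) = x / G"
    "dist (center C1) (center C3) = y / G"
    using pos Gpos
    by (simp_all add: C dist_Pair_Pair dist_real_def)
      (simp add: power_divide pyth real_sqrt_divide flip: add_divide_distrib)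
  have rad: "radius C1 = r1 / G" "radius C2 = r2 / G" "radius C3 = r3 / G" "radius C4 = r4 / G"
    by (simp_all add: C)
  have enc: "encloses C4 C1" "encloses C4 C2" "encloses C4 C3"
    using rpos Gpos rsum
    by (simp_all add: encloses_iff dd rad divide_le_cancel flip: add_divide_distrib)
  have less: "radius C1 < radius C4" "radius C2 < radius C4" "radius C3 < radius C4"
    using rsum pos Gpos by (simp_all add: rad divide_strict_right_mono)
  \<comment> \<open>The first three circles are smaller than \<open>C4\<close> and cannot enclose
    it, so their curvatures get the positive sign.\<close>
  have "\<not> encloses K C4" if "radius K < radius C4" for K
  proof -
    have "radius C4 \<ge> 0" using rpos Gpos by (simp add: rad)
    then show ?thesis
      using that zero_le_dist[of "center K" "center C4"] unfolding encloses_iff[OF \<open>radius C4 \<ge> 0\<close>]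
      by linarith
  qed
  then have nenc: "\<not> encloses C1 C4" "\<not> encloses C2 C4" "\<not> encloses C3 C4"
    using less by blast+
  have ne: "C4 \<noteq> C1" "C4 \<noteq> C2" "C4 \<noteq> C3"
    using less by blast+
  have oc: "oriented_curvature {C1, C2, C3, C4} C1 = r4" "oriented_curvature {C1, C2, C3, C4} C2 = r3"
    "oriented_curvature {C1, C2, C3, C4} C3 = r2" "oriented_curvature {C1, C2, C3, C4} C4 = - r1"
    using enc nenc ne inv by (auto simp: oriented_curvature_def rad)

  \<comment> \<open>The rectangle in the packing and the Descartes equation\<close>
  have rect: "is_rectangle (center C1) (center C2) (center C4) (center C3)"
    using pos Gpos by (simp add: is_rectangle_def C)
  \<comment> \<open>Zero reflections already put the generating circles into the packing.\<close>
  have "[C1, C2, C3, C4] \<in> {Q. descartes_reflection\<^sup>*\<^sup>* [C1, C2, C3, C4] Q}" by simp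
  then have sub: "set [C1, C2, C3, C4] \<subseteq> apollonian_packing [C1, C2, C3, C4]"
    unfolding apollonian_packing_def by (rule UN_upper)
  have packing: "\<exists>D1 D2 D3 D4. {D1, D2, D3, D4} \<subseteq> apollonian_packing [C1, C2, C3, C4] \<and>
      is_rectangle (center D1) (center D2) (center D3) (center D4)"
    by (rule exI[of _ C1], rule exI[of _ C2], rule exI[of _ C4], rule exI[of _ C3])
      (use sub rect in auto)
  \<comment> \<open>The curvatures sum to \<open>2 * z\<close> and their squares to
    \<open>x\<^sup>2 + y\<^sup>2 + z\<^sup>2\<close>, so the equation is the Pythagorean
    relation.\<close>
  have "descartes_equation r4 r3 r2 (- r1)"
    using pyth by (simp add: descartes_equation_def r power2_eq_square field_simps)
  then show ?thesis
    using rect dd quad enc oc k gcd' packing integral_quadruple_imp_integral_packing[OF iq]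
    unfolding xyz by blast
qed

end
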